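(* Let $n\in\mathbb{N}\cup\{\infty\}$, let $T\in\mathcal{S}_n(\mathcal{H})$, and let $\Gamma$ be a model for $T$, with associated space $\mathcal{H}(\Gamma)$. Then the operator $M_\Gamma$ defined on $$\mathscr{D}(M_\Gamma):=\{\widehat f\in\mathcal{H}(\Gamma): z\widehat f\in\mathcal{H}(\Gamma)\}$$ by $M_\Gamma\widehat f=z\widehat f$ (multiplication by the independent variable) is densely defined and belongs to $\mathcal{S}_n(\mathcal{H}(\Gamma))$. Moreover, $M_\Gamma$ is unitarily equivalent to $T$.
   Context: $\mathcal{S}_n(\mathcal{H})$ denotes the set of closed, densely defined linear operators $T:\mathscr{D}(T)\subset\mathcal{H}\to\mathcal{H}$ on a complex separable Hilbert space $\mathcal{H}$ that are symmetric ($\langle Tx,y\rangle=\langle x,Ty\rangle$ for all $x,y\in\mathscr{D}(T)$), simple ($\bigcap_{\Im\lambda\neq0}\mathrm{Rng}(T-\lambda I)=\{0\}$), and have deficiency indices $(n,n)$, i.e. $\dim\mathrm{Rng}(T-iI)^\perp=\dim\mathrm{Rng}(T+iI)^\perp=n$. Operators $T_1,T_2$ on $\mathcal{H}_1,\mathcal{H}_2$ are unitarily equivalent if there is a unitary $U:\mathcal{H}_1\to\mathcal{H}_2$ with $U\mathscr{D}(T_1)=\mathscr{D}(T_2)$ and $UT_1=T_2U$. $\mathbb{C}_\pm$ are the open upper/lower half planes. $\mathcal{K}$ is a complex separable Hilbert space of dimension $n$. A model for $T$ is a map $\Gamma:\mathbb{C}\setminus\mathbb{R}\to\mathcal{B}(\mathcal{K},\mathcal{H})$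 such that: (1) $\Gamma$ is co-analytic (analytic in $\overline{\lambda}$); (2) for each $\lambda\in\mathbb{C}\setminus\mathbb{R}$, $\Gamma(\lambda)$ is an invertible map from $\mathcal{K}$ onto $\mathrm{Rng}(T-\lambda I)^\perp$; (3) $\Gamma(z)^*\Gamma(\lambda):\mathcal{K}\to\mathcal{K}$ is invertible whenever $\lambda,z\in\mathbb{C}_+$ or $\lambda,z\in\mathbb{C}_-$; (4) the closed linear span of $\bigcup_{\Im\lambda\ne0}\mathrm{Rng}\,\Gamma(\lambda)$ is $\mathcal{H}$. For $f\in\mathcal{H}$, $\widehat f(\lambda):=\Gamma(\lambda)^*f$ ($\lambda\in\mathbb{C}\setminus\mathbb{R}$), and $\mathcal{H}(\Gamma):=\{\widehat f:f\in\mathcal{H}\}$ is the Hilbert space of $\mathcal{K}$-valued analytic functions on $\mathbb{C}\setminus\mathbb{R}$ with inner product $\langle\widehat f,\widehat g\rangle_{\mathcal{H}(\Gamma)}:=\langle f,g\rangle_{\mathcal{H}}$. *)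

theory Defs
  imports
    "HOL-Analysis.Analysis"
    "HOL-Library.Function_Algebras"
    "HOL-Library.Extended_Nat"
begin

section \<open>Complex vector spaces and complex Hilbert spaces\<close>

class complex_vector = ab_group_add +
  fixes scaleC :: "complex \<Rightarrow> 'a \<Rightarrow> 'a"  (infixr "*\<^sub>C" 75)
  assumes scaleC_add_right: "a *\<^sub>C (x + y) = a *\<^sub>C x + a *\<^sub>C y"
    and scaleC_add_left: "(a + b) *\<^sub>C x = a *\<^sub>C x + b *\<^sub>C x"
    and scaleC_scaleC: "a *\<^sub>C (b *\<^sub>C x) = (a * b) *\<^sub>C x"
    and scaleC_one: "1 *\<^sub>C x = x"

global_interpretation complex_vector:
  vector_space "scaleC :: complex \<Rightarrow> 'a \<Rightarrow> 'a::complex_vector"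
  by unfold_locales
    (simp_all add: scaleC_add_right scaleC_add_left scaleC_scaleC scaleC_one)

text \<open>Pointwise scalar multiplication; addition of functions is that of
  \<^theory>\<open>HOL-Library.Function_Algebras\<close>.\<close>

instantiation "fun" :: (type, complex_vector) complex_vector
begin

definition "a *\<^sub>C f = (\<lambda>x. a *\<^sub>C f x)"

instance
  by standard
    (simp_all add: scaleC_fun_def fun_eq_iff scaleC_add_right scaleC_add_left
      scaleC_scaleC scaleC_one)

end

text \<open>The complex inner product is linear in the first argument; the real norm
  and topology of the type are those induced by it.\<close>

class complex_inner = complex_vector + real_inner +
  fixes cinner :: "'a \<Rightarrow> 'a \<Rightarrow> complex"
  assumes scaleR_scaleC: "r *\<^sub>R x = complex_of_real r *\<^sub>C x"
    and cinner_add_left: "cinner (x + y) z = cinner x z + cinner y z"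
    and cinner_scaleC_left: "cinner (a *\<^sub>C x) y = a * cinner x y"
    and cinner_commute: "cinner x y = cnj (cinner y x)"
    and inner_eq_Re_cinner: "inner x y = Re (cinner x y)"

class chilbert_space = complex_inner + complete_space

text \<open>The space of functions attached to a model depends on the model, so it cannot
  be a type. Operator-theoretic notions are therefore defined for a complex subspace
  of a type, equipped with its own inner product.\<close>

record 'a inner_space =
  hcarrier :: "'a set"
  hinner :: "'a \<Rightarrow> 'a \<Rightarrow> complex"

definition type_space :: "'a::complex_inner inner_space" where
  "type_space = \<lparr>hcarrier = UNIV, hinner = cinner\<rparr>"

text \<open>The value 0 outside the carrier is there because \<^locale>\<open>Metric_space\<close> asks for
  nonnegativity and symmetry on the whole type.\<close>

definition hdist :: "'a::complex_vector inner_space \<Rightarrow> 'a \<Rightarrow> 'a \<Rightarrow> real" where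
  "hdist V x y =
    (if x \<in> hcarrier V \<and> y \<in> hcarrier V then sqrt (Re (hinner V (x - y) (x - y))) else 0)"

definition htop :: "'a::complex_vector inner_space \<Rightarrow> 'a topology" where
  "htop V = Metric_space.mtopology (hcarrier V) (hdist V)"

definition separable_hilbert_space :: "'a::complex_vector inner_space \<Rightarrow> bool" where
  "separable_hilbert_space V \<longleftrightarrow>
    complex_vector.subspace (hcarrier V) \<and>
    (\<forall>x\<in>hcarrier V. \<forall>y\<in>hcarrier V. \<forall>z\<in>hcarrier V.
      hinner V (x + y) z = hinner V x z + hinner V y z) \<and>
    (\<forall>a. \<forall>x\<in>hcarrier V. \<forall>y\<in>hcarrier V. hinner V (a *\<^sub>C x) y = a * hinner V x y) \<and>
    (\<forall>x\<in>hcarrier V. \<forall>y\<in>hcarrier V. hinner V x y = cnj (hinner V y x)) \<and>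
    (\<forall>x\<in>hcarrier V. x \<noteq> 0 \<longrightarrow> 0 < Re (hinner V x x)) \<and>
    Metric_space.mcomplete (hcarrier V) (hdist V) \<and>
    separable_space (htop V)"

definition orth_compl :: "'a inner_space \<Rightarrow> 'a set \<Rightarrow> 'a set" where
  "orth_compl V A = {y \<in> hcarrier V. \<forall>x\<in>A. hinner V x y = 0}"

text \<open>For a closed subspace of a separable Hilbert space, being infinite-dimensional
  means having Hilbert dimension \<open>\<aleph>\<^sub>0\<close>, and finite Hilbert and linear dimensions agree.\<close>

definition edim :: "'a::complex_vector set \<Rightarrow> enat" where
  "edim W = (if \<exists>B. finite B \<and> W \<subseteq> complex_vector.span B
             then enat (complex_vector.dim W) else \<infinity>)"

section \<open>Unbounded operators\<close>

text \<open>An operator is a pair of its domain and a function; the values of the function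
  outside the domain are irrelevant.\<close>

type_synonym 'a operator = "'a set \<times> ('a \<Rightarrow> 'a)"

definition linear_operator :: "'a::complex_vector inner_space \<Rightarrow> 'a operator \<Rightarrow> bool" where
  "linear_operator V = (\<lambda>(D, T).
    complex_vector.subspace D \<and> D \<subseteq> hcarrier V \<and> T ` D \<subseteq> hcarrier V \<and>
    (\<forall>x\<in>D. \<forall>y\<in>D. T (x + y) = T x + T y) \<and>
    (\<forall>a. \<forall>x\<in>D. T (a *\<^sub>C x) = a *\<^sub>C T x))"

definition densely_defined :: "'a::complex_vector inner_space \<Rightarrow> 'a operator \<Rightarrow> bool" where
  "densely_defined V = (\<lambda>(D, T). htop V closure_of D = hcarrier V)"

definition closed_operator :: "'a::complex_vector inner_space \<Rightarrow> 'a operator \<Rightarrow> bool" where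
  "closed_operator V = (\<lambda>(D, T).
    closedin (prod_topology (htop V) (htop V)) ((\<lambda>x. (x, T x)) ` D))"

definition symmetric_operator :: "'a inner_space \<Rightarrow> 'a operator \<Rightarrow> bool" where
  "symmetric_operator V = (\<lambda>(D, T).
    \<forall>x\<in>D. \<forall>y\<in>D. hinner V (T x) y = hinner V x (T y))"

definition rng_shift :: "'a::complex_vector operator \<Rightarrow> complex \<Rightarrow> 'a set" where
  "rng_shift = (\<lambda>(D, T) l. (\<lambda>x. T x - l *\<^sub>C x) ` D)"

definition simple_operator :: "'a::complex_vector operator \<Rightarrow> bool" where
  "simple_operator T \<longleftrightarrow> (\<Inter>l\<in>{l. Im l \<noteq> 0}. rng_shift T l) = {0}"

definition S_class :: "enat \<Rightarrow> 'a::complex_vector inner_space \<Rightarrow> 'a operator set" where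
  "S_class n V = {T. separable_hilbert_space V \<and>
    linear_operator V T \<and> densely_defined V T \<and> closed_operator V T \<and>
    symmetric_operator V T \<and> simple_operator T \<and>
    edim (orth_compl V (rng_shift T \<i>)) = n \<and>
    edim (orth_compl V (rng_shift T (- \<i>))) = n}"

definition unitary ::
    "'a::complex_vector inner_space \<Rightarrow> 'b::complex_vector inner_space \<Rightarrow> ('a \<Rightarrow> 'b) \<Rightarrow> bool" where
  "unitary V W U \<longleftrightarrow>
    bij_betw U (hcarrier V) (hcarrier W) \<and>
    (\<forall>x\<in>hcarrier V. \<forall>y\<in>hcarrier V. U (x + y) = U x + U y) \<and>
    (\<forall>a. \<forall>x\<in>hcarrier V. U (a *\<^sub>C x) = a *\<^sub>C U x) \<and>
    (\<forall>x\<in>hcarrier V. \<forall>y\<in>hcarrier V. hinner W (U x) (U y) = hinner V x y)"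

definition unitarily_equivalent ::
    "'a::complex_vector inner_space \<Rightarrow> 'a operator \<Rightarrow>
     'b::complex_vector inner_space \<Rightarrow> 'b operator \<Rightarrow> bool" where
  "unitarily_equivalent V S W T \<longleftrightarrow>
    (\<exists>U. unitary V W U \<and> U ` fst S = fst T \<and> (\<forall>x\<in>fst S. U (snd S x) = snd T (U x)))"

section \<open>Models\<close>

text \<open>The complex counterpart of \<^const>\<open>adjoint\<close>.\<close>

definition cadjoint :: "('a::complex_inner \<Rightarrow> 'b::complex_inner) \<Rightarrow> 'b \<Rightarrow> 'a" where
  "cadjoint A = (SOME B. \<forall>x y. cinner (A x) y = cinner x (B y))"

definition invertible_onto :: "('a::real_normed_vector \<Rightarrow> 'b::real_normed_vector) \<Rightarrow> 'b set \<Rightarrow> bool" where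
  "invertible_onto A W \<longleftrightarrow> bij_betw A UNIV W \<and> (\<exists>C. \<forall>x. norm x \<le> C * norm (A x))"

text \<open>Co-analyticity is complex differentiability with respect to the conjugate
  variable, for the operator norm: the real derivative is conjugate-linear.\<close>

definition co_analytic_on ::
    "complex set \<Rightarrow> (complex \<Rightarrow> 'k::complex_inner \<Rightarrow>\<^sub>L 'h::complex_inner) \<Rightarrow> bool" where
  "co_analytic_on S G \<longleftrightarrow>
    (\<forall>l\<in>S. \<exists>L. (G has_derivative L) (at l) \<and>
      (\<forall>h x. blinfun_apply (L h) x = cnj h *\<^sub>C blinfun_apply (L 1) x))"

text \<open>Only the values of \<open>G\<close> off the real axis matter; \<open>\<Rightarrow>\<^sub>L\<close> is the type of bounded
  real-linear maps, whence the explicit complex linearity.\<close>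

definition is_model ::
    "'h::chilbert_space operator \<Rightarrow> (complex \<Rightarrow> 'k::chilbert_space \<Rightarrow>\<^sub>L 'h) \<Rightarrow> bool" where
  "is_model T G \<longleftrightarrow>
    (\<forall>l. Im l \<noteq> 0 \<longrightarrow> Vector_Spaces.linear scaleC scaleC (blinfun_apply (G l))) \<and>
    co_analytic_on {l. Im l \<noteq> 0} G \<and>
    (\<forall>l. Im l \<noteq> 0 \<longrightarrow> invertible_onto (blinfun_apply (G l)) (orth_compl type_space (rng_shift T l))) \<and>
    (\<forall>l z. (Im l > 0 \<and> Im z > 0) \<or> (Im l < 0 \<and> Im z < 0) \<longrightarrow>
      invertible_onto (cadjoint (blinfun_apply (G z)) \<circ> blinfun_apply (G l)) UNIV) \<and>
    closure (complex_vector.span (\<Union>l\<in>{l. Im l \<noteq> 0}. range (blinfun_apply (G l)))) = UNIV"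

text \<open>Functions on \<open>\<complex> - \<real>\<close> are represented by total functions vanishing on \<open>\<real>\<close>.\<close>

definition hat ::
    "(complex \<Rightarrow> 'k::chilbert_space \<Rightarrow>\<^sub>L 'h::chilbert_space) \<Rightarrow> 'h \<Rightarrow> complex \<Rightarrow> 'k" where
  "hat G f = (\<lambda>l. if Im l \<noteq> 0 then cadjoint (blinfun_apply (G l)) f else 0)"

definition model_space ::
    "(complex \<Rightarrow> 'k::chilbert_space \<Rightarrow>\<^sub>L 'h::chilbert_space) \<Rightarrow> (complex \<Rightarrow> 'k) inner_space" where
  "model_space G =
    \<lparr>hcarrier = range (hat G),
     hinner = (\<lambda>F F'. cinner (inv (hat G) F) (inv (hat G) F'))\<rparr>"

definition mult_op ::
    "(complex \<Rightarrow> 'k::chilbert_space \<Rightarrow>\<^sub>L 'h::chilbert_space) \<Rightarrow> (complex \<Rightarrow> 'k) operator" where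
  "mult_op G =
    ({F \<in> hcarrier (model_space G). (\<lambda>z. z *\<^sub>C F z) \<in> hcarrier (model_space G)},
     (\<lambda>F z. z *\<^sub>C F z))"

end

theory Submission
  imports Defs
begin

text \<open>Since the ranges of \<open>\<Gamma> l\<close> span a dense subspace, \<open>f \<mapsto> hat \<Gamma> f\<close> is a unitary map onto the
  model space. The range of \<open>\<Gamma> l\<close> being orthogonal to that of \<open>T - l\<close>, it carries \<open>T\<close> into
  multiplication by \<open>z\<close>. Conversely \<open>z \<cdot> hat \<Gamma> f = hat \<Gamma> g\<close> puts \<open>g - l f\<close> into the closed range
  of \<open>T - l\<close> for every nonreal \<open>l\<close>, which forces \<open>f\<close> into the domain of \<open>T\<close>. Hence multiplication
  by \<open>z\<close> is exactly the unitary transport of \<open>T\<close> and inherits all its properties.\<close>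

section \<open>Projections, adjoints and closed ranges\<close>

lemma projection_theorem:
  fixes S :: "'a::{real_inner, complete_space} set"
  assumes S: "subspace S" and "closed S"
  obtains y where "y \<in> S" "\<And>s. s \<in> S \<Longrightarrow> inner (x - y) s = 0"
proof -
  define N where "N = (\<lambda>y. (norm (x - y))\<^sup>2)"
  define q where "q = Inf (N ` S)"
  have bdd: "bdd_below (N ` S)"
    by (intro bdd_belowI[of _ 0]) (auto simp: N_def)
  have ne: "N ` S \<noteq> {}"
    using subspace_0[OF S] by auto
  have q_le: "q \<le> N y" if "y \<in> S" for y
    unfolding q_def using bdd that by (intro cInf_lower) auto
  have "\<exists>y\<in>S. N y < q + 1 / real (Suc n)" for n
  proof -
    have "Inf (N ` S) < q + 1 / real (Suc n)"
      by (simp add: q_def)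
    then show ?thesis
      using cInf_lessD[OF ne] by blast
  qed
  then obtain y where yS: "\<And>n. y n \<in> S" and yN: "\<And>n. N (y n) < q + 1 / real (Suc n)"
    by metis
  \<comment> \<open>Parallelogram law for \<open>x - y m\<close> and \<open>x - y n\<close>: the
    midpoint of \<open>y m\<close> and \<open>y n\<close> lies in \<open>S\<close>, so its
    \<open>N\<close> is at least \<open>q\<close>, and a minimising sequence is Cauchy.\<close>
  have parallelogram: "(norm (y m - y n))\<^sup>2 \<le> 2 / real (Suc m) + 2 / real (Suc n)" for m n
  proof -
    have "(norm (y m - y n))\<^sup>2 = 2 * N (y m) + 2 * N (y n) - 4 * N ((1/2) *\<^sub>R (y m + y n))"
      unfolding N_def power2_norm_eq_inner
      by (simp add: inner_add_left inner_add_right inner_diff_left inner_diff_right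
          inner_commute algebra_simps)
    moreover have "q \<le> N ((1/2) *\<^sub>R (y m + y n))"
      using S yS by (intro q_le subspace_scale subspace_add)
    ultimately show ?thesis
      using yN[of m] yN[of n] by simp
  qed
  have "Cauchy y"
  proof (rule metric_CauchyI)
    fix e :: real assume "0 < e"
    then obtain M where M: "4 / e\<^sup>2 < real M"
      using reals_Archimedean2 by blast
    show "\<exists>M. \<forall>m\<ge>M. \<forall>n\<ge>M. dist (y m) (y n) < e"
    proof (intro exI allI impI)
      fix m n assume mn: "M \<le> m" "M \<le> n"
      have pos: "0 < real M"
        using M \<open>0 < e\<close> by (smt (verit) divide_pos_pos zero_less_power)
      have "2 / real (Suc m) \<le> 2 / real M" "2 / real (Suc n) \<le> 2 / real M"
        using mn pos by (auto intro!: divide_left_mono)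
      then have "(norm (y m - y n))\<^sup>2 \<le> 4 / real M"
        using parallelogram[of m n] by simp
      also have "\<dots> < e\<^sup>2"
        using M pos \<open>0 < e\<close> by (simp add: field_simps)
      finally show "dist (y m) (y n) < e"
        using \<open>0 < e\<close> by (simp add: dist_norm power_less_imp_less_base)
    qed
  qed
  then obtain p where p: "y \<longlonglongrightarrow> p"
    using Cauchy_convergent convergent_def by blast
  have pS: "p \<in> S"
    using \<open>closed S\<close> yS p closed_sequentially by blast
  have "(\<lambda>n. N (y n)) \<longlonglongrightarrow> N p"
    unfolding N_def by (intro tendsto_intros p)
  moreover have "(\<lambda>n. q + 1 / real (Suc n)) \<longlonglongrightarrow> q + 0"
    by (intro tendsto_intros LIMSEQ_Suc[OF lim_1_over_n])
  ultimately have "N p \<le> q + 0"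
    using yN by (intro LIMSEQ_le) (auto intro: less_imp_le)
  have "inner (x - p) s = 0" if "s \<in> S" for s
  proof (cases "s = 0")
    case False
    \<comment> \<open>The \<open>t\<close> that minimises \<open>N\<close> along the line through
      \<open>p\<close> in direction \<open>s\<close>; a nonzero inner product would push
      \<open>N\<close> below the minimum attained at \<open>p\<close>.\<close>
    define t where "t = inner (x - p) s / inner s s"
    have "N p \<le> N (p + t *\<^sub>R s)"
      using \<open>N p \<le> q + 0\<close> q_le[of "p + t *\<^sub>R s"] S pS that
      by (auto intro: order_trans subspace_add subspace_scale)
    also have "N (p + t *\<^sub>R s) = N p - 2 * t * inner (x - p) s + t\<^sup>2 * inner s s"
      unfolding N_def power2_norm_eq_inner
      by (simp add: inner_add_left inner_add_right inner_diff_left inner_diff_right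
          inner_commute algebra_simps power2_eq_square)
    also have "\<dots> = N p - (inner (x - p) s)\<^sup>2 / inner s s"
      using False by (simp add: t_def field_simps power2_eq_square)
    finally have "(inner (x - p) s)\<^sup>2 / inner s s \<le> 0"
      by simp
    moreover have "0 < inner s s"
      using False by simp
    ultimately show ?thesis
      by (simp add: divide_le_0_iff not_le[symmetric])
  qed simp
  with pS that show thesis by blast
qed

text \<open>The kernel has codimension at most one. If \<phi> is nonzero, the component
  \<open>e\<close> of some \<open>x\<close> orthogonal to the kernel spans the complement, and a
  multiple of \<open>e\<close> represents \<phi>.\<close>

lemma riesz_representation:
  fixes \<phi> :: "'a::{real_inner, complete_space} \<Rightarrow> real"
  assumes "bounded_linear \<phi>"
  obtains w where "\<And>x. \<phi> x = inner x w"
proof (cases "\<forall>x. \<phi> x = 0")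
  case True
  then show thesis
    using that[of 0] by simp
next
  case False
  interpret bounded_linear \<phi> by fact
  define K where "K = {x. \<phi> x = 0}"
  have "subspace K"
    by (auto simp: K_def subspace_def zero add scaleR)
  moreover have "closed K"
    unfolding K_def by (intro closed_Collect_eq continuous_intros linear_continuous_on assms)
  moreover obtain x where x: "\<phi> x \<noteq> 0"
    using False by blast
  ultimately obtain y where y: "y \<in> K" "\<And>s. s \<in> K \<Longrightarrow> inner (x - y) s = 0"
    using projection_theorem by blast
  define e where "e = x - y"
  have e: "\<phi> e = \<phi> x"
    using y(1) by (simp add: e_def K_def diff)
  then have "e \<noteq> 0"
    using x zero by auto
  have "\<phi> v = inner v ((\<phi> e / inner e e) *\<^sub>R e)" for v
  proof -
    have "v - (\<phi> v / \<phi> e) *\<^sub>R e \<in> K"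
      using x e by (simp add: K_def diff scaleR)
    then have "inner e v = \<phi> v / \<phi> e * inner e e"
      using y(2) by (fastforce simp: e_def[symmetric] inner_diff_right)
    then show ?thesis
      using x e \<open>e \<noteq> 0\<close> by (simp add: inner_commute field_simps)
  qed
  then show thesis by (rule that)
qed

section \<open>Complex inner products, adjoints and double orthogonal complements\<close>

lemma cinner_scaleC_right: "cinner x (a *\<^sub>C y) = cnj a * cinner x y"
  by (metis cinner_commute cinner_scaleC_left complex_cnj_cnj complex_cnj_mult)

lemma cinner_add_right: "cinner x (y + z) = cinner x y + cinner x z"
  by (simp only: cinner_commute[of x "y + z"] cinner_commute[of x y] cinner_commute[of x z]
      cinner_add_left complex_cnj_add)

lemma cinner_zero_left [simp]: "cinner 0 x = 0"
  using cinner_add_left[of 0 0 x] by simp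

lemma cinner_zero_right [simp]: "cinner x 0 = 0"
  using cinner_commute[of x 0] by simp

lemma cinner_diff_left: "cinner (x - y) z = cinner x z - cinner y z"
  using cinner_add_left[of "x - y" y z] by (simp add: algebra_simps)

lemma cinner_diff_right: "cinner x (y - z) = cinner x y - cinner x z"
  by (simp only: cinner_commute[of x "y - z"] cinner_commute[of x y] cinner_commute[of x z]
      cinner_diff_left complex_cnj_diff)

lemma cinner_self: "cinner x x = complex_of_real ((norm x)\<^sup>2)"
  using arg_cong[OF cinner_commute[of x x], of Im]
  by (simp add: complex_eq_iff power2_norm_eq_inner inner_eq_Re_cinner)

lemma cinner_self_eq_0 [simp]: "cinner x x = 0 \<longleftrightarrow> x = 0"
  by (simp add: cinner_self)

text \<open>Upgrades facts about the real inner product to complex ones: what holds for both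
  \<open>x\<close> and \<i> times \<open>x\<close> controls the real and the imaginary part.\<close>

lemma Im_cinner: "Im (cinner x y) = - inner (\<i> *\<^sub>C x) y"
  by (simp add: inner_eq_Re_cinner cinner_scaleC_left)


text \<open>\<open>cadjoint\<close> is a choice, so an adjoint must be exhibited. Riesz supplies it
  for the real inner product, and complex linearity of \<open>A\<close> at \<i> times
  \<open>x\<close> settles the imaginary part.\<close>

lemma cinner_cadjoint:
  fixes A :: "'a::chilbert_space \<Rightarrow> 'b::complex_inner"
  assumes "bounded_linear A" and "Vector_Spaces.linear scaleC scaleC A"
  shows "cinner (A x) y = cinner x (cadjoint A y)"
proof -
  interpret A: Vector_Spaces.linear scaleC scaleC A by fact
  have "\<exists>w. \<forall>x. cinner (A x) y = cinner x w" for y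
  proof -
    have "bounded_linear (\<lambda>x. inner (A x) y)"
      using assms(1) by (intro bounded_linear_inner_left_comp)
    then obtain w where w: "\<And>x. inner (A x) y = inner x w"
      using riesz_representation by blast
    have "cinner (A x) y = cinner x w" for x
    proof (rule complex_eqI)
      show "Re (cinner (A x) y) = Re (cinner x w)"
        using w by (simp add: inner_eq_Re_cinner)
      show "Im (cinner (A x) y) = Im (cinner x w)"
        using w[of "\<i> *\<^sub>C x"] by (simp add: Im_cinner A.scale)
    qed
    then show ?thesis by blast
  qed
  then have "\<exists>B. \<forall>x y. cinner (A x) y = cinner x (B y)"
    by metis
  then show ?thesis
    unfolding cadjoint_def by (rule someI2_ex) simp
qed

text \<open>With \<open>p\<close> the real projection of \<open>f\<close> onto \<open>R\<close>,
  stability of \<open>R\<close> under \<i> makes \<open>f - p\<close> complex-orthogonal to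
  \<open>R\<close>. It is then orthogonal to \<open>f\<close> and to \<open>p\<close>, hence to
  itself.\<close>

lemma orth_compl_orth_compl_subset:
  fixes R :: "'a::chilbert_space set"
  assumes R: "complex_vector.subspace R" and "closed R"
  shows "orth_compl type_space (orth_compl type_space R) \<subseteq> R"
proof
  fix f assume f: "f \<in> orth_compl type_space (orth_compl type_space R)"
  have "subspace R"
    using R by (auto simp: subspace_def complex_vector.subspace_def scaleR_scaleC)
  then obtain p where p: "p \<in> R" "\<And>s. s \<in> R \<Longrightarrow> inner (f - p) s = 0"
    using projection_theorem \<open>closed R\<close> by blast
  have perp: "cinner s (f - p) = 0" if "s \<in> R" for s
  proof (rule complex_eqI)
    show "Re (cinner s (f - p)) = Re 0"
      using p(2)[OF that] by (simp add: inner_eq_Re_cinner[symmetric] inner_commute)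
    have "\<i> *\<^sub>C s \<in> R"
      using R that by (rule complex_vector.subspace_scale)
    then show "Im (cinner s (f - p)) = Im 0"
      using p(2) by (simp add: Im_cinner inner_commute)
  qed
  then have "f - p \<in> orth_compl type_space R"
    by (simp add: orth_compl_def type_space_def)
  then have "cinner (f - p) f = 0"
    using f by (simp add: orth_compl_def type_space_def)
  moreover have "cinner (f - p) p = 0"
    by (simp only: cinner_commute[of "f - p" p] perp[OF p(1)] complex_cnj_zero)
  ultimately have "cinner (f - p) (f - p) = 0"
    by (simp only: cinner_diff_right[of "f - p" f p]) simp
  then show "f \<in> R"
    using p(1) by simp
qed

section \<open>Topology of the ambient space and closed ranges of shifted symmetric
  operators\<close>

lemma hdist_type_space: "hdist type_space = dist"
  by (simp add: fun_eq_iff hdist_def type_space_def inner_eq_Re_cinner[symmetric]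
      norm_eq_sqrt_inner dist_norm)

lemma hcarrier_type_space [simp]: "hcarrier type_space = UNIV"
  and hinner_type_space [simp]: "hinner type_space = cinner"
  by (simp_all add: type_space_def)

lemma htop_type_space: "htop type_space = euclidean"
  by (simp add: htop_def hdist_type_space)

lemma norm_i_scaleC: "norm (\<i> *\<^sub>C x) = norm (x :: 'a::complex_inner)"
  by (simp add: norm_eq_sqrt_inner inner_eq_Re_cinner cinner_scaleC_left cinner_scaleC_right)

lemma abs_Im_cinner_le: "\<bar>Im (cinner x y)\<bar> \<le> norm x * norm (y :: 'a::complex_inner)"
  using Cauchy_Schwarz_ineq2[of "\<i> *\<^sub>C x" y] by (simp add: Im_cinner norm_i_scaleC)

text \<open>Symmetry makes \<open>cinner (T x) x\<close> real, so the imaginary part of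
  \<open>cinner (T x - l *\<^sub>C x) x\<close> comes from \<open>l\<close> alone; Cauchy-Schwarz
  bounds it.\<close>

lemma symmetric_shift_bound:
  assumes "symmetric_operator type_space (D, T)" and x: "(x :: 'a::complex_inner) \<in> D"
  shows "\<bar>Im l\<bar> * norm x \<le> norm (T x - l *\<^sub>C x)"
proof (cases "x = 0")
  case False
  have "cinner (T x) x = cnj (cinner (T x) x)"
    using assms cinner_commute[of x "T x"] by (simp add: symmetric_operator_def)
  then have "Im (cinner (T x) x) = 0"
    by (metis Reals_cnj_iff complex_is_Real_iff)
  then have "\<bar>Im (cinner (T x - l *\<^sub>C x) x)\<bar> = \<bar>Im l\<bar> * (norm x)\<^sup>2"
    by (simp add: cinner_diff_left cinner_scaleC_left cinner_self abs_mult)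
  then have "(\<bar>Im l\<bar> * norm x) * norm x \<le> norm (T x - l *\<^sub>C x) * norm x"
    using abs_Im_cinner_le[of "T x - l *\<^sub>C x" x] by (simp add: power2_eq_square mult.assoc)
  then show ?thesis
    using False by simp
qed simp

text \<open>For nonreal scalars the norm is tied to \<open>scaleC\<close> only through
  \<open>cinner\<close>; computing the norm from it gives the bound \<open>cmod a\<close>.\<close>

lemma bounded_linear_scaleC: "bounded_linear (\<lambda>x :: 'a::complex_inner. a *\<^sub>C x)"
proof
  show "a *\<^sub>C (r *\<^sub>R x) = r *\<^sub>R (a *\<^sub>C x)" for r and x :: 'a
    by (simp add: scaleR_scaleC scaleC_scaleC mult.commute)
  have "norm (a *\<^sub>C x) = norm x * cmod a" for x :: 'a
  proof -
    have "complex_of_real ((norm (a *\<^sub>C x))\<^sup>2) = (a * cnj a) * cinner x x"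
      by (simp add: cinner_self[symmetric] cinner_scaleC_left cinner_scaleC_right
          mult.left_commute mult.assoc del: of_real_power)
    also have "\<dots> = complex_of_real ((norm x * cmod a)\<^sup>2)"
      by (simp only: cinner_self complex_norm_square[symmetric] power_mult_distrib
          of_real_mult of_real_power mult.commute)
    finally have "(norm (a *\<^sub>C x))\<^sup>2 = (norm x * cmod a)\<^sup>2"
      by (simp only: of_real_eq_iff)
    then show ?thesis
      by (simp add: power2_eq_iff_nonneg)
  qed
  then show "\<exists>K. \<forall>x :: 'a. norm (a *\<^sub>C x) \<le> norm x * K"
    by (intro exI[of _ "cmod a"]) simp
qed (simp add: scaleC_add_right)

text \<open>By \<open>symmetric_shift_bound\<close>, convergent values of \<open>A - l\<close> have
  Cauchy preimages. Then \<open>A (x n)\<close> converges as well, and the closed graph places the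
  limit in the domain.\<close>

lemma closed_rng_shift:
  fixes T :: "'a::chilbert_space operator"
  assumes lin: "linear_operator type_space T"
    and clo: "closed_operator type_space T"
    and sym: "symmetric_operator type_space T"
    and l: "Im l \<noteq> 0"
  shows "closed (rng_shift T l)"
proof -
  obtain D A where T: "T = (D, A)" by force
  have D: "complex_vector.subspace D"
    and A_add: "\<And>x y. x \<in> D \<Longrightarrow> y \<in> D \<Longrightarrow> A (x + y) = A x + A y"
    and A_scale: "\<And>a x. x \<in> D \<Longrightarrow> A (a *\<^sub>C x) = a *\<^sub>C A x"
    using lin by (auto simp: linear_operator_def T)
  have A_diff: "A (x - y) = A x - A y" if "x \<in> D" "y \<in> D" for x y
    using A_add[of "x - y" y] complex_vector.subspace_diff[OF D that] that by simp
  have graph: "closed ((\<lambda>x. (x, A x)) ` D)"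
    using clo by (simp add: closed_operator_def T htop_type_space flip: euclidean_product_topology)
  show ?thesis
    unfolding closed_sequential_limits
  proof (intro allI impI)
    fix u v assume "(\<forall>n. u n \<in> rng_shift T l) \<and> u \<longlonglongrightarrow> v"
    then have u: "\<And>n. u n \<in> rng_shift T l" and uv: "u \<longlonglongrightarrow> v" by auto
    have "\<exists>x\<in>D. u n = A x - l *\<^sub>C x" for n
      using u[of n] by (auto simp: T rng_shift_def)
    then obtain x where x: "\<And>n. x n \<in> D" and ux: "\<And>n. u n = A (x n) - l *\<^sub>C x n"
      by metis
    have bound: "\<bar>Im l\<bar> * dist (x m) (x n) \<le> dist (u m) (u n)" for m n
    proof -
      have "u m - u n = A (x m - x n) - l *\<^sub>C (x m - x n)"
        by (simp add: ux A_diff x complex_vector.scale_right_diff_distrib)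
      then show ?thesis
        using symmetric_shift_bound[OF sym[unfolded T], of "x m - x n" l]
          complex_vector.subspace_diff[OF D x x] by (simp add: dist_norm)
    qed
    have "Cauchy x"
    proof (rule metric_CauchyI)
      fix e :: real assume "0 < e"
      then have "0 < \<bar>Im l\<bar> * e" using l by simp
      then obtain M where "\<forall>m\<ge>M. \<forall>n\<ge>M. dist (u m) (u n) < \<bar>Im l\<bar> * e"
        using LIMSEQ_imp_Cauchy[OF uv] metric_CauchyD by blast
      then have "\<forall>m\<ge>M. \<forall>n\<ge>M. \<bar>Im l\<bar> * dist (x m) (x n) < \<bar>Im l\<bar> * e"
        using bound by (meson le_less_trans)
      then show "\<exists>M. \<forall>m\<ge>M. \<forall>n\<ge>M. dist (x m) (x n) < e"
        using l by (auto simp: mult_less_cancel_left)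
    qed
    then obtain p where p: "x \<longlonglongrightarrow> p"
      using Cauchy_convergent convergent_def by blast
    have "(\<lambda>n. u n + l *\<^sub>C x n) \<longlonglongrightarrow> v + l *\<^sub>C p"
      by (intro tendsto_add uv bounded_linear.tendsto[OF bounded_linear_scaleC p])
    then have lim: "(\<lambda>n. (x n, A (x n))) \<longlonglongrightarrow> (p, v + l *\<^sub>C p)"
      using p by (intro tendsto_Pair) (simp_all add: ux)
    have "(p, v + l *\<^sub>C p) \<in> (\<lambda>x. (x, A x)) ` D"
      by (rule closed_sequentially[OF graph _ lim]) (use x in blast)
    then have "p \<in> D" and "A p = v + l *\<^sub>C p"
      by auto
    then show "v \<in> rng_shift T l"
      unfolding T rng_shift_def prod.case by (intro image_eqI[of _ _ p]) simp_all
  qed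
qed

lemma subspace_rng_shift:
  assumes "linear_operator V T"
  shows "complex_vector.subspace (rng_shift T l)"
proof -
  obtain D A where T: "T = (D, A)" by force
  have D: "complex_vector.subspace D"
    and add: "\<And>x y. x \<in> D \<Longrightarrow> y \<in> D \<Longrightarrow> A (x + y) = A x + A y"
    and scale: "\<And>a x. x \<in> D \<Longrightarrow> A (a *\<^sub>C x) = a *\<^sub>C A x"
    using assms by (auto simp: linear_operator_def T)
  show ?thesis
    unfolding T rng_shift_def complex_vector.subspace_def prod.case
  proof (intro conjI ballI allI)
    show "0 \<in> (\<lambda>x. A x - l *\<^sub>C x) ` D"
      using complex_vector.subspace_0[OF D] scale[of 0 0] by force
  next
    fix u v assume "u \<in> (\<lambda>x. A x - l *\<^sub>C x) ` D" "v \<in> (\<lambda>x. A x - l *\<^sub>C x) ` D"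
    then obtain x y where "x \<in> D" "y \<in> D" "u = A x - l *\<^sub>C x" "v = A y - l *\<^sub>C y" by auto
    then show "u + v \<in> (\<lambda>x. A x - l *\<^sub>C x) ` D"
      using complex_vector.subspace_add[OF D]
      by (intro image_eqI[of _ _ "x + y"]) (simp_all add: add scaleC_add_right)
  next
    fix c u assume "u \<in> (\<lambda>x. A x - l *\<^sub>C x) ` D"
    then obtain x where "x \<in> D" "u = A x - l *\<^sub>C x" by auto
    then show "c *\<^sub>C u \<in> (\<lambda>x. A x - l *\<^sub>C x) ` D"
      using complex_vector.subspace_scale[OF D]
      by (intro image_eqI[of _ _ "c *\<^sub>C x"])
        (simp_all add: scale scaleC_scaleC mult.commute complex_vector.scale_right_diff_distrib)
  qed
qed


section \<open>Transport of operators along unitary maps\<close>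

context
  fixes V :: "'b::complex_vector inner_space" and U :: "'h::chilbert_space \<Rightarrow> 'b"
  assumes U: "unitary type_space V U"
begin

lemma unitary_add: "U (x + y) = U x + U y"
  and unitary_scale: "U (a *\<^sub>C x) = a *\<^sub>C U x"
  and unitary_hinner: "hinner V (U x) (U y) = cinner x y"
  and unitary_range: "hcarrier V = range U"
  and unitary_inj: "inj U"
  using U by (auto simp: unitary_def bij_betw_def)

lemma unitary_linear: "Vector_Spaces.linear scaleC scaleC U"
  by unfold_locales (simp_all add: unitary_add unitary_scale)

interpretation U: Vector_Spaces.linear scaleC scaleC U
  by (rule unitary_linear)

lemma unitary_0: "U 0 = 0"
  using unitary_scale[of 0 0] by simp

lemma unitary_diff: "U (x - y) = U x - U y"
  using unitary_add[of "x - y" y] by (simp add: algebra_simps)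

lemma unitary_hdist: "hdist V (U x) (U y) = dist x y"
  by (simp add: hdist_def unitary_range unitary_hinner inner_eq_Re_cinner[symmetric]
      dist_norm norm_eq_sqrt_inner flip: unitary_diff)

lemma unitary_Metric_space: "Metric_space (hcarrier V) (hdist V)"
proof
  \<comment> \<open>Off the carrier \<open>hdist\<close> takes the value 0, which settles the second
    case here and in the symmetry below.\<close>
  show "0 \<le> hdist V x y" for x y
    by (cases "x \<in> hcarrier V \<and> y \<in> hcarrier V")
      (auto simp: unitary_range unitary_hdist, auto simp: hdist_def unitary_range)
  show "hdist V x y = hdist V y x" for x y
    by (cases "x \<in> hcarrier V \<and> y \<in> hcarrier V")
      (auto simp: unitary_range unitary_hdist dist_commute, auto simp: hdist_def unitary_range)
  show "hdist V x y = 0 \<longleftrightarrow> x = y" if "x \<in> hcarrier V" "y \<in> hcarrier V" for x y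
    using that by (auto simp: unitary_range unitary_hdist)
  show "hdist V x z \<le> hdist V x y + hdist V y z"
    if "x \<in> hcarrier V" "y \<in> hcarrier V" "z \<in> hcarrier V" for x y z
    using that by (auto simp: unitary_range unitary_hdist dist_triangle)
qed

text \<open>A surjective isometry is a homeomorphism. Limits, separability, dense domains and closed
  graphs are carried across by it.\<close>

lemma unitary_homeomorphic: "homeomorphic_map euclidean (htop V) U"
proof -
  interpret Metric_space12 UNIV "dist :: 'h \<Rightarrow> 'h \<Rightarrow> real" "hcarrier V" "hdist V"
    by (intro Metric_space12.intro Met_TC.Metric_space_axioms unitary_Metric_space)
  show ?thesis
    using isometry_imp_homeomorphic_map[of U]
    by (simp add: unitary_range unitary_hdist htop_def)
qed

text \<open>Completeness is metric rather than topological: the isometry pulls a Cauchy sequence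
  back to the complete space \<open>'h\<close>, and continuity pushes its limit forward.\<close>

lemma unitary_mcomplete: "Metric_space.mcomplete (hcarrier V) (hdist V)"
proof -
  interpret M: Metric_space "hcarrier V" "hdist V"
    by (rule unitary_Metric_space)
  show ?thesis
    unfolding M.mcomplete_def
  proof (intro allI impI)
    fix \<sigma> assume \<sigma>: "M.MCauchy \<sigma>"
    define \<tau> where "\<tau> = inv U \<circ> \<sigma>"
    have \<sigma>_eq: "\<sigma> = U \<circ> \<tau>"
    proof
      fix n
      have "\<sigma> n \<in> range U"
        using \<sigma> unfolding M.MCauchy_def by (auto simp: unitary_range)
      then show "\<sigma> n = (U \<circ> \<tau>) n"
        by (simp add: \<tau>_def f_inv_into_f)
    qed
    have "Cauchy \<tau>"
      using \<sigma> unfolding M.MCauchy_def by (auto simp: \<sigma>_eq unitary_hdist Cauchy_def)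
    then obtain x where "\<tau> \<longlonglongrightarrow> x"
      using Cauchy_convergent convergent_def by blast
    then have "limitin (htop V) \<sigma> (U x) sequentially"
      unfolding \<sigma>_eq using homeomorphic_imp_continuous_map[OF unitary_homeomorphic]
      by (intro continuous_map_limit) auto
    then show "\<exists>x. limitin M.mtopology \<sigma> x sequentially"
      by (auto simp: htop_def)
  qed
qed

lemma unitary_separable_hilbert_space:
  assumes "separable_hilbert_space (type_space :: 'h inner_space)"
  shows "separable_hilbert_space V"
proof -
  have "separable_space (htop V)"
    using assms homeomorphic_separable_space[OF
        homeomorphic_map_imp_homeomorphic_space[OF unitary_homeomorphic]]
    by (simp add: separable_hilbert_space_def htop_type_space)
  moreover have "complex_vector.subspace (hcarrier V)"
    unfolding unitary_range
    by (intro U.subspace_image complex_vector.subspace_UNIV)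
  moreover have "0 < Re (hinner V x x)" if "x \<in> hcarrier V" "x \<noteq> 0" for x
    using that by (auto simp: unitary_range unitary_hinner unitary_0 simp flip: inner_eq_Re_cinner)
  ultimately show ?thesis
    unfolding separable_hilbert_space_def using unitary_mcomplete
    by (auto simp: unitary_range unitary_hinner cinner_add_left cinner_scaleC_left
        intro: cinner_commute simp flip: unitary_add unitary_scale)
qed

text \<open>One maximal independent \<open>B\<close> in \<open>W\<close> decides both sides. Its
  image is independent and generates the image of \<open>W\<close>, so either finiteness condition
  amounts to \<open>B\<close> being finite, and the dimensions agree.\<close>

lemma unitary_edim: "edim (U ` W) = edim W"
proof -
  obtain B where B: "B \<subseteq> W" "complex_vector.independent B" "W \<subseteq> complex_vector.span B"
    using complex_vector.maximal_independent_subset by blast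
  have indep: "complex_vector.independent (U ` B)"
    using B(2) unitary_inj by (intro U.independent_injective_image) (auto intro: inj_on_subset)
  have span: "U ` W \<subseteq> complex_vector.span (U ` B)"
    using B(3) by (auto simp: U.span_image)
  have inj: "inj_on U B"
    using unitary_inj by (auto intro: inj_on_subset)
  have "finite B" if "finite C" "W \<subseteq> complex_vector.span C" for C
    using complex_vector.independent_span_bound[OF that(1) B(2)] B(1) that(2) by auto
  moreover have "finite B" if "finite C" "U ` W \<subseteq> complex_vector.span C" for C
    using complex_vector.independent_span_bound[OF that(1) indep] B(1) that(2) inj
    by (auto simp: finite_image_iff)
  ultimately have "(\<exists>C. finite C \<and> U ` W \<subseteq> complex_vector.span C) \<longleftrightarrow>
      (\<exists>C. finite C \<and> W \<subseteq> complex_vector.span C)"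
    using B(3) span by (meson finite_imageI)
  moreover have "complex_vector.dim (U ` W) = complex_vector.dim W"
    using complex_vector.basis_card_eq_dim[OF B(1,3,2)]
      complex_vector.basis_card_eq_dim[OF image_mono[OF B(1)] span indep] inj
    by (simp add: card_image)
  ultimately show ?thesis
    by (simp add: edim_def)
qed

lemma unitary_orth_compl: "orth_compl V (U ` R) = U ` orth_compl type_space R"
  by (auto simp: orth_compl_def unitary_range unitary_hinner)

text \<open>The final equivalence runs from the model space to the ambient one, so it uses the
  inverse of the transform.\<close>

lemma unitary_inv: "unitary V type_space (inv U)"
  unfolding unitary_def
  by (auto simp: unitary_range unitary_inj unitary_hinner inj_imp_bij_betw_inv
      simp flip: unitary_add unitary_scale)

section \<open>Transport of operators intertwined by a unitary map\<close>

context
  fixes D :: "'h set" and A :: "'h \<Rightarrow> 'h" and M :: "'b \<Rightarrow> 'b"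
  assumes intertwine: "\<And>x. x \<in> D \<Longrightarrow> M (U x) = U (A x)"
begin

lemma unitary_rng_shift: "rng_shift (U ` D, M) l = U ` rng_shift (D, A) l"
  by (simp add: rng_shift_def image_image intertwine unitary_diff unitary_scale)

text \<open>The new graph is the image of the old one under \<open>U\<close> acting on both
  coordinates, which is a homeomorphism of the product spaces.\<close>

lemma unitary_closed_operator:
  assumes "closed_operator type_space (D, A)"
  shows "closed_operator V (U ` D, M)"
proof -
  obtain g where g: "homeomorphic_maps euclidean (htop V) U g"
    using unitary_homeomorphic homeomorphic_map_maps by blast
  then have "homeomorphic_maps (prod_topology euclidean euclidean)
      (prod_topology (htop V) (htop V)) (\<lambda>(x, y). (U x, U y)) (\<lambda>(x, y). (g x, g y))"
    by (simp only: homeomorphic_maps_prod) simp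
  then have prod: "homeomorphic_map (prod_topology euclidean euclidean)
      (prod_topology (htop V) (htop V)) (\<lambda>(x, y). (U x, U y))"
    using homeomorphic_maps_map by blast
  have "(\<lambda>x. (x, M x)) ` U ` D = (\<lambda>(x, y). (U x, U y)) ` (\<lambda>x. (x, A x)) ` D"
    by (simp add: image_image intertwine)
  then show ?thesis
    using assms homeomorphic_map_closedness_eq[OF prod]
    by (simp add: closed_operator_def htop_type_space)
qed

lemma unitary_S_class:
  assumes T: "(D, A) \<in> S_class n type_space"
  shows "(U ` D, M) \<in> S_class n V"
proof -
  have D: "complex_vector.subspace D"
    and lin: "\<And>x y. x \<in> D \<Longrightarrow> y \<in> D \<Longrightarrow> A (x + y) = A x + A y"
      "\<And>a x. x \<in> D \<Longrightarrow> A (a *\<^sub>C x) = a *\<^sub>C A x"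
    and sym: "\<And>x y. x \<in> D \<Longrightarrow> y \<in> D \<Longrightarrow> cinner (A x) y = cinner x (A y)"
    and dense: "closure D = UNIV"
    and simple: "(\<Inter>l\<in>{l. Im l \<noteq> 0}. rng_shift (D, A) l) = {0}"
    using T by (auto simp: S_class_def linear_operator_def symmetric_operator_def
        densely_defined_def simple_operator_def htop_type_space)
  have "linear_operator V (U ` D, M)"
    using U.subspace_image[OF D] complex_vector.subspace_add[OF D]
      complex_vector.subspace_scale[OF D]
    by (auto simp: linear_operator_def unitary_range intertwine lin
        simp flip: unitary_add unitary_scale)
  moreover have "densely_defined V (U ` D, M)"
    using homeomorphic_map_closure_of[OF unitary_homeomorphic, of D] dense
    by (simp add: densely_defined_def unitary_range)
  moreover have "symmetric_operator V (U ` D, M)"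
    by (auto simp: symmetric_operator_def intertwine unitary_hinner sym)
  moreover have "simple_operator (U ` D, M)"
  proof -
    \<comment> \<open>Injectivity lets the image commute with the intersection; the point \<i>
      witnesses that the index set is nonempty.\<close>
    have "(\<Inter>l\<in>{l. Im l \<noteq> 0}. U ` rng_shift (D, A) l) = U ` (\<Inter>l\<in>{l. Im l \<noteq> 0}. rng_shift (D, A) l)"
      by (rule image_INT[symmetric, OF unitary_inj, where j = \<i>]) auto
    then show ?thesis
      by (simp add: simple_operator_def unitary_rng_shift simple unitary_0)
  qed
  ultimately show ?thesis
    using T unitary_closed_operator unitary_separable_hilbert_space
    by (simp add: S_class_def unitary_rng_shift unitary_orth_compl unitary_edim)
qed

end

end

section \<open>The transform attached to a model\<close>

context
  fixes T :: "'h::chilbert_space operator"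
    and \<Gamma> :: "complex \<Rightarrow> 'k::chilbert_space \<Rightarrow>\<^sub>L 'h"
  assumes model: "is_model T \<Gamma>"
begin

text \<open>Off the real axis \<open>hat\<close> is handled from here on through this pairing,
  without returning to the choice in \<open>cadjoint\<close>.\<close>

lemma cinner_hat:
  assumes "Im l \<noteq> 0"
  shows "cinner k (hat \<Gamma> f l) = cinner (\<Gamma> l k) f"
  using assms model
  by (simp add: hat_def is_model_def cinner_cadjoint blinfun.bounded_linear_right)

text \<open>Serves to recognise a function as a transform: pairing with \<open>k\<close> equal to
  the difference of the two values forces it to vanish. The second premise matches the convention
  that transforms are 0 on the real axis.\<close>

lemma hat_eqI:
  assumes "\<And>l k. Im l \<noteq> 0 \<Longrightarrow> cinner k (F l) = cinner (\<Gamma> l k) f"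
    and "\<And>l. Im l = 0 \<Longrightarrow> F l = 0"
  shows "hat \<Gamma> f = F"
proof
  fix l
  show "hat \<Gamma> f l = F l"
  proof (cases "Im l = 0")
    case False
    then have "cinner (hat \<Gamma> f l - F l) (hat \<Gamma> f l - F l) = 0"
      by (subst cinner_diff_right) (simp add: cinner_hat assms(1))
    then show ?thesis by simp
  qed (simp add: assms(2) hat_def)
qed

text \<open>The ranges span a dense subspace. Passing to the closure in the real condition
  \<open>inner x f = 0\<close> suffices, since it then holds at \<open>x = f\<close>.\<close>

lemma orthogonal_model_eq_0:
  assumes "\<And>l k. Im l \<noteq> 0 \<Longrightarrow> cinner (\<Gamma> l k) f = 0"
  shows "f = 0"
proof -
  let ?G = "\<Union>l\<in>{l. Im l \<noteq> 0}. range (blinfun_apply (\<Gamma> l))"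
  have "complex_vector.span ?G \<subseteq> {x. cinner x f = 0}"
    using assms
    by (intro complex_vector.span_minimal)
      (auto simp: complex_vector.subspace_def cinner_add_left cinner_scaleC_left)
  then have "complex_vector.span ?G \<subseteq> {x. inner x f = 0}"
    by (auto simp: inner_eq_Re_cinner)
  moreover have "closed {x. inner x f = 0}"
    by (intro closed_Collect_eq continuous_intros)
  ultimately have "closure (complex_vector.span ?G) \<subseteq> {x. inner x f = 0}"
    by (rule closure_minimal)
  moreover have "closure (complex_vector.span ?G) = UNIV"
    using model by (simp add: is_model_def)
  ultimately have "inner f f = 0"
    by blast
  then show ?thesis by simp
qed

text \<open>Injectivity is the density of the spanned ranges. The inner product of
  \<open>model_space\<close> is pulled back along \<open>inv (hat \<Gamma>)\<close>, so injectivity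
  gives the isometry.\<close>

lemma unitary_hat: "unitary type_space (model_space \<Gamma>) (hat \<Gamma>)"
proof -
  have add: "hat \<Gamma> (f + g) = hat \<Gamma> f + hat \<Gamma> g" for f g
    by (rule hat_eqI) (simp_all add: cinner_add_right cinner_hat, simp add: hat_def)
  have scale: "hat \<Gamma> (a *\<^sub>C f) = a *\<^sub>C hat \<Gamma> f" for a f
    by (rule hat_eqI) (simp_all add: scaleC_fun_def cinner_scaleC_right cinner_hat, simp add: hat_def)
  have "f = g" if "hat \<Gamma> f = hat \<Gamma> g" for f g
  proof -
    have "cinner (\<Gamma> l k) (f - g) = 0" if "Im l \<noteq> 0" for l k
      using \<open>hat \<Gamma> f = hat \<Gamma> g\<close> that by (simp add: cinner_diff_right flip: cinner_hat)
    then have "f - g = 0"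
      by (rule orthogonal_model_eq_0)
    then show ?thesis by simp
  qed
  then have "inj (hat \<Gamma>)"
    by (rule injI)
  then show ?thesis
    by (auto simp: unitary_def model_space_def bij_betw_def add scale)
qed

text \<open>Differentiability in operator norm gives continuity at each vector, which later recovers
  the excluded point \<i> as a limit.\<close>

lemma continuous_model:
  assumes "Im l \<noteq> 0"
  shows "((\<lambda>z. \<Gamma> z k) \<longlongrightarrow> \<Gamma> l k) (at l)"
proof -
  obtain L where "(\<Gamma> has_derivative L) (at l)"
    using model assms by (auto simp: is_model_def co_analytic_on_def)
  then have "isCont \<Gamma> l"
    by (rule has_derivative_continuous)
  then show ?thesis
    by (intro blinfun.tendsto tendsto_const) (simp add: isCont_def)
qed

section \<open>Multiplication by the variable as the transform of the operator\<close>

context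
  fixes D :: "'h set" and A :: "'h \<Rightarrow> 'h"
  assumes T_eq: "T = (D, A)"
begin

lemma range_model:
  "Im l \<noteq> 0 \<Longrightarrow> range (\<Gamma> l) = orth_compl type_space (rng_shift (D, A) l)"
  using model by (auto simp: is_model_def invertible_onto_def bij_betw_def T_eq)

lemma cinner_model_shift:
  assumes "Im l \<noteq> 0" and "u \<in> rng_shift (D, A) l"
  shows "cinner (\<Gamma> l k) u = 0"
proof -
  have "\<Gamma> l k \<in> orth_compl type_space (rng_shift (D, A) l)"
    using range_model[OF assms(1)] by blast
  then have "cinner u (\<Gamma> l k) = 0"
    using assms(2) by (simp add: orth_compl_def)
  then show ?thesis
    by (simp add: cinner_commute[of "\<Gamma> l k" u])
qed

text \<open>The range of \<open>\<Gamma> l\<close> is orthogonal to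
  \<open>A x - l *\<^sub>C x\<close>, so \<open>A x\<close> and \<open>l *\<^sub>C x\<close> have
  the same pairing with \<open>\<Gamma> l k\<close>.\<close>

lemma hat_operator:
  assumes "x \<in> D"
  shows "hat \<Gamma> (A x) = (\<lambda>z. z *\<^sub>C hat \<Gamma> x z)"
proof (rule hat_eqI)
  fix l k assume l: "Im l \<noteq> 0"
  have "A x - l *\<^sub>C x \<in> rng_shift (D, A) l"
    using assms by (auto simp: rng_shift_def)
  then show "cinner k (l *\<^sub>C hat \<Gamma> x l) = cinner (\<Gamma> l k) (A x)"
    using cinner_model_shift[OF l, of "A x - l *\<^sub>C x" k] l
    by (simp add: cinner_diff_right cinner_scaleC_right cinner_hat)
qed (simp add: hat_def)

text \<open>Subtracting the solution \<open>x\<close> of \<open>(A - \<i>) x = g - \<i> f\<close> leaves \<open>f - x\<close> in the range of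
  \<open>A - l\<close> for all nonreal \<open>l \<noteq> \<i>\<close>. Continuity of the model covers \<open>l = \<i>\<close>, and completeness of
  the model gives \<open>f = x\<close>.\<close>

lemma mult_hat_imp_domain:
  assumes lin: "linear_operator type_space (D, A)"
    and clo: "\<And>l. Im l \<noteq> 0 \<Longrightarrow> closed (rng_shift (D, A) l)"
    and hat: "hat \<Gamma> g = (\<lambda>z. z *\<^sub>C hat \<Gamma> f z)"
  shows "f \<in> D"
proof -
  have orth: "cinner (\<Gamma> l k) (g - l *\<^sub>C f) = 0" if "Im l \<noteq> 0" for l k
    using that fun_cong[OF hat, of l]
    by (simp add: cinner_diff_right cinner_scaleC_right flip: cinner_hat)
  \<comment> \<open>The range of \<open>\<Gamma> \<i>\<close> is the orthogonal complement of the
    closed range of \<open>A - \<i>\<close>, so orthogonality to it makes the equation for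
    \<open>x\<close> solvable.\<close>
  have "g - \<i> *\<^sub>C f \<in> orth_compl type_space (range (\<Gamma> \<i>))"
    using orth[of \<i>] by (auto simp: orth_compl_def)
  then have "g - \<i> *\<^sub>C f \<in> rng_shift (D, A) \<i>"
    using orth_compl_orth_compl_subset[OF subspace_rng_shift[OF lin] clo, of \<i>]
    by (auto simp: range_model)
  then obtain x where x: "x \<in> D" "g - \<i> *\<^sub>C f = A x - \<i> *\<^sub>C x"
    by (auto simp: rng_shift_def)
  have off_i: "cinner (\<Gamma> l k) (f - x) = 0" if l: "Im l \<noteq> 0" "l \<noteq> \<i>" for l k
  proof -
    \<comment> \<open>The choice of \<open>x\<close> says that \<open>g - A x\<close> is \<i> times
      \<open>f - x\<close>, so \<open>g\<close> and \<open>A x\<close> drop out.\<close>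
    have "(g - l *\<^sub>C f) - (A x - l *\<^sub>C x) = (\<i> - l) *\<^sub>C (f - x)"
      using x(2) by (simp add: complex_vector.scale_right_diff_distrib
          complex_vector.scale_left_diff_distrib algebra_simps)
    moreover have "A x - l *\<^sub>C x \<in> rng_shift (D, A) l"
      using x(1) by (auto simp: rng_shift_def)
    ultimately have "cinner (\<Gamma> l k) ((\<i> - l) *\<^sub>C (f - x)) = 0"
      using orth[OF l(1), of k] cinner_model_shift[OF l(1), of "A x - l *\<^sub>C x" k]
        cinner_diff_right[of "\<Gamma> l k" "g - l *\<^sub>C f" "A x - l *\<^sub>C x"] by simp
    moreover have "cnj (\<i> - l) \<noteq> 0"
      using l by (simp only: complex_cnj_zero_iff) simp
    ultimately show ?thesis
      by (simp only: cinner_scaleC_right mult_eq_0_iff) simp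
  qed
  have at_i: "inner (\<Gamma> \<i> k) (f - x) = 0" for k
  proof (rule tendsto_unique)
    show "((\<lambda>z. inner (\<Gamma> z k) (f - x)) \<longlongrightarrow> inner (\<Gamma> \<i> k) (f - x)) (at \<i>)"
      by (intro tendsto_intros continuous_model) simp
    \<comment> \<open>The open upper half plane is a neighbourhood of \<i> free of real points, so
      \<open>off_i\<close> applies on it away from \<i>.\<close>
    have "eventually (\<lambda>z. z \<in> {z. 0 < Im z} \<and> z \<noteq> \<i>) (at \<i>)"
      using eventually_at_in_open[OF open_halfspace_Im_gt, of \<i> 0] by simp
    then have "eventually (\<lambda>z. inner (\<Gamma> z k) (f - x) = 0) (at \<i>)"
      by eventually_elim (simp add: inner_eq_Re_cinner off_i)
    then show "((\<lambda>z. inner (\<Gamma> z k) (f - x)) \<longlongrightarrow> 0) (at \<i>)"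
      by (rule tendsto_eventually)
  qed simp
  have "cinner (\<Gamma> \<i> k) (f - x) = 0" for k
  proof (rule complex_eqI)
    show "Re (cinner (\<Gamma> \<i> k) (f - x)) = Re 0"
      using at_i by (simp add: inner_eq_Re_cinner)
    interpret G: Vector_Spaces.linear scaleC scaleC "blinfun_apply (\<Gamma> \<i>)"
      using model by (simp add: is_model_def)
    show "Im (cinner (\<Gamma> \<i> k) (f - x)) = Im 0"
      using at_i[of "\<i> *\<^sub>C k"] by (simp add: Im_cinner G.scale)
  qed
  with off_i have "f - x = 0"
    by (intro orthogonal_model_eq_0) (metis)
  then show ?thesis
    using x(1) by simp
qed

text \<open>The maximal domain of multiplication is the image of \<open>D\<close>:
  \<open>mult_hat_imp_domain\<close> gives one inclusion, \<open>hat_operator\<close> the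
  other.\<close>

lemma mult_op_eq:
  assumes "linear_operator type_space (D, A)"
    and "\<And>l. Im l \<noteq> 0 \<Longrightarrow> closed (rng_shift (D, A) l)"
  shows "mult_op \<Gamma> = (hat \<Gamma> ` D, \<lambda>F z. z *\<^sub>C F z)"
proof -
  have "{F \<in> range (hat \<Gamma>). (\<lambda>z. z *\<^sub>C F z) \<in> range (hat \<Gamma>)} = hat \<Gamma> ` D"
  proof (intro subset_antisym subsetI)
    fix F assume "F \<in> {F \<in> range (hat \<Gamma>). (\<lambda>z. z *\<^sub>C F z) \<in> range (hat \<Gamma>)}"
    then obtain f g where "F = hat \<Gamma> f" "hat \<Gamma> g = (\<lambda>z. z *\<^sub>C F z)"
      by fastforce
    then show "F \<in> hat \<Gamma> ` D"
      using mult_hat_imp_domain[OF assms] by blast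
  next
    fix F assume "F \<in> hat \<Gamma> ` D"
    then show "F \<in> {F \<in> range (hat \<Gamma>). (\<lambda>z. z *\<^sub>C F z) \<in> range (hat \<Gamma>)}"
      by (auto simp flip: hat_operator)
  qed
  then show ?thesis
    by (simp add: mult_op_def model_space_def)
qed

end

end

section \<open>Class membership and unitary equivalence of the multiplication operator\<close>

theorem proposition2p18:
  fixes n :: enat
    and T :: "'h::{chilbert_space, second_countable_topology} operator"
    and \<Gamma> :: "complex \<Rightarrow> 'k::{chilbert_space, second_countable_topology} \<Rightarrow>\<^sub>L 'h"
  assumes "edim (UNIV :: 'k set) = n"
    and "T \<in> S_class n type_space"
    and "is_model T \<Gamma>"
  shows "densely_defined (model_space \<Gamma>) (mult_op \<Gamma>) \<and>
    mult_op \<Gamma> \<in> S_class n (model_space \<Gamma>) \<and>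
    unitarily_equivalent (model_space \<Gamma>) (mult_op \<Gamma>) type_space T"
proof -
  obtain D A where T: "T = (D, A)" by force
  note U = unitary_hat[OF assms(3)]
  have lin: "linear_operator type_space (D, A)"
    and "closed_operator type_space (D, A)" "symmetric_operator type_space (D, A)"
    using assms(2) by (auto simp: S_class_def T)
  then have clo: "closed (rng_shift (D, A) l)" if "Im l \<noteq> 0" for l
    using closed_rng_shift that by blast
  have mult: "mult_op \<Gamma> = (hat \<Gamma> ` D, \<lambda>F z. z *\<^sub>C F z)"
    using clo by (rule mult_op_eq[OF assms(3) T lin])
  note intertwine = hat_operator[OF assms(3) T, symmetric]
  have S: "mult_op \<Gamma> \<in> S_class n (model_space \<Gamma>)"
    unfolding mult using assms(2) by (intro unitary_S_class[OF U]) (simp_all add: T intertwine)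
  then have "densely_defined (model_space \<Gamma>) (mult_op \<Gamma>)"
    by (simp add: S_class_def)
  moreover have "unitarily_equivalent (model_space \<Gamma>) (mult_op \<Gamma>) type_space T"
    unfolding unitarily_equivalent_def mult T
    using unitary_inv[OF U] unitary_inj[OF U]
    by (intro exI[of _ "inv (hat \<Gamma>)"]) (auto simp: intertwine image_image)
  ultimately show ?thesis
    using S by blast
qed

end
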